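(* Fix a sparsity $s\in\mathbb Z_{\ge1}$ and let $\mathcal T_s$ denote the set of vectors $\theta\in\mathcal T$ with $|\mathrm{supp}(\theta)|=s$. There exists a universal constant $A>0$ (not depending on $\sigma$ or $n$) such that for any $\sigma\ge\max_{\theta\in\mathcal T_s}\|\theta\|$ and any $n\ge 1$, $$\inf_{\tilde\theta_n}\ \sup_{\theta\in\mathcal T_s}\ \mathbb E_\theta\big[\rho(\tilde\theta_n,\theta)\big]\ \ge\ A\,\min\Big\{\frac{\sigma^2}{\sqrt n},\,1\Big\},$$ where the infimum is taken over all estimators $\tilde\theta_n$ (measurable functions with values in $\mathbb R^L$) based on $n$ i.i.d. samples from $P_\theta$.
   Context: Fix a dimension $L\ge1$ and identify $\mathbb R^L$ with functions $\mathbb Z/L\mathbb Z\to\mathbb R$. Let $\mathcal R=\{R^{(\ell)}:1\le \ell\le L\}$ be the group of cyclic shifts, $(R^{(\ell)}\theta)(i)=\theta(i+\ell)$. For $\theta,\phi\in\mathbb R^L$ let $\rho(\theta,\phi)=\min_{G\in\mathcal R}\|\theta-G\phi\|$ (Euclidean norm). For noise level $\sigma>0$, $P_\theta$ is the law of $X=G\theta+\sigma\xi$, where $G$ is uniform on $\mathcal R$ and $\xi\sim\mathcal N(0,I_L)$ is independent of $G$; $\mathbb E_\theta$ denotes expectation when the samples are i.i.d. from $P_\theta$. A vector $\theta\in\mathbb R^L$ is collision-free if every element of the multiset $\mathcal D(\theta)=\{i-j \ (\mathrm{mod}\ L): i,j\in\mathrm{supp}(\theta),\ i\ne j\}$ has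 multiplicity exactly $1$. Fix positive constants $m,M,\epsilon$. $\mathcal T$ is the set of $\theta\in\mathbb R^L$ such that (i) $\theta$ is collision-free; (ii) $\sigma\ge\|\theta\|$; (iii) $m\le|\theta(i)|\le M$ for all $i\in\mathrm{supp}(\theta)$ and $|\mathrm{supp}(\theta)|\ge\max\{7,(2+\epsilon)M^2/m^2\}$. The quantities $L,m,M,\epsilon$ are fixed throughout.
   Formalization: It is assumed that m<M (for m=M the set T_s is finite and the bound fails for large n) and that T_s is nonempty; the maximum of the norms bounding σ is taken over vectors of sparsity s satisfying (i) and (iii), without (ii). *)

theory Defs
  imports "HOL-Probability.Probability" "Berlekamp_Zassenhaus.Finite_Field"
begin

text \<open>
  The type \<open>'l mod_ring\<close> is the ring of integers modulo \<open>CARD('l)\<close>, so for \<open>'l :: finite\<close> the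
  Euclidean space of functions from the residues modulo \<open>L = CARD('l) \<ge> 1\<close> to the reals is
  the following one, with index arithmetic modulo \<open>L\<close>.
\<close>

type_synonym 'l signal = "(real, 'l mod_ring) vec"

definition cyclic_shift :: "'l::finite mod_ring \<Rightarrow> 'l signal \<Rightarrow> 'l signal" where
  "cyclic_shift l \<theta> = (\<chi> i. \<theta> $ (i + l))"

definition cyclic_shifts :: "('l::finite signal \<Rightarrow> 'l signal) set" where
  "cyclic_shifts = range cyclic_shift"

definition orbit_dist :: "'l::finite signal \<Rightarrow> 'l signal \<Rightarrow> real" where
  "orbit_dist \<theta> \<phi> = Min ((\<lambda>G. norm (\<theta> - G \<phi>)) ` cyclic_shifts)"

definition std_gaussian :: "'l::finite signal measure" where
  "std_gaussian = density lborel (\<lambda>x. ennreal (\<Prod>i\<in>UNIV. std_normal_density (x $ i)))"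

text \<open>The law of \<open>G \<theta> + \<sigma> \<xi>\<close> with \<open>G\<close> uniform on the cyclic shifts and \<open>\<xi>\<close> an independent
  standard Gaussian vector.\<close>

definition sample_law :: "real \<Rightarrow> 'l::finite signal \<Rightarrow> 'l signal measure" where
  "sample_law \<sigma> \<theta> =
     distr (uniform_count_measure cyclic_shifts \<Otimes>\<^sub>M std_gaussian) borel
       (\<lambda>(G, \<xi>). G \<theta> + \<sigma> *\<^sub>R \<xi>)"

text \<open>The estimators are the measurable functions of \<open>n\<close> samples. The risk is an integral with values
  in \<open>ennreal\<close>, so an estimator whose risk is infinite is not mistaken for one of risk zero.\<close>

definition estimators :: "nat \<Rightarrow> ((nat \<Rightarrow> 'l::finite signal) \<Rightarrow> 'l signal) set" where
  "estimators n = (\<Pi>\<^sub>M i\<in>{..<n}. borel) \<rightarrow>\<^sub>M borel"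

definition risk :: "real \<Rightarrow> nat \<Rightarrow> ((nat \<Rightarrow> 'l::finite signal) \<Rightarrow> 'l signal) \<Rightarrow> 'l signal \<Rightarrow> ennreal" where
  "risk \<sigma> n est \<theta> =
     (\<integral>\<^sup>+ X. ennreal (orbit_dist (est X) \<theta>) \<partial>(\<Pi>\<^sub>M i\<in>{..<n}. sample_law \<sigma> \<theta>))"

definition supp :: "'l::finite signal \<Rightarrow> 'l mod_ring set" where
  "supp \<theta> = {i. \<theta> $ i \<noteq> 0}"

definition differences :: "'l::finite signal \<Rightarrow> 'l mod_ring multiset" where
  "differences \<theta> =
     image_mset (\<lambda>(i, j). i - j) (mset_set {(i, j). i \<in> supp \<theta> \<and> j \<in> supp \<theta> \<and> i \<noteq> j})"

definition collision_free :: "'l::finite signal \<Rightarrow> bool" where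
  "collision_free \<theta> \<longleftrightarrow> (\<forall>d \<in># differences \<theta>. count (differences \<theta>) d = 1)"

text \<open>The conditions on a signal that do not involve the noise level are kept separate from the
  condition \<open>norm \<theta> \<le> \<sigma>\<close>: the largest norm with which \<open>\<sigma>\<close> is compared in the theorem is taken
  over a class that must not itself depend on \<open>\<sigma>\<close>.\<close>

definition sparse_signals :: "real \<Rightarrow> real \<Rightarrow> real \<Rightarrow> 'l::finite signal set" where
  "sparse_signals m M \<epsilon> = {\<theta>. collision_free \<theta> \<and>
     (\<forall>i \<in> supp \<theta>. m \<le> \<bar>\<theta> $ i\<bar> \<and> \<bar>\<theta> $ i\<bar> \<le> M) \<and>
     real (card (supp \<theta>)) \<ge> max 7 ((2 + \<epsilon>) * M\<^sup>2 / m\<^sup>2)}"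

definition signal_class :: "real \<Rightarrow> real \<Rightarrow> real \<Rightarrow> real \<Rightarrow> 'l::finite signal set" where
  "signal_class \<sigma> m M \<epsilon> = {\<theta> \<in> sparse_signals m M \<epsilon>. \<sigma> \<ge> norm \<theta>}"

definition with_sparsity :: "nat \<Rightarrow> 'l::finite signal set \<Rightarrow> 'l signal set" where
  "with_sparsity s T = {\<theta> \<in> T. card (supp \<theta>) = s}"

end

theory Submission
  imports Defs
begin

text \<open>
  Le Cam's two-point method. Let \<open>\<theta>\<close> be constant on an admissible support and let \<open>\<phi> = \<theta> + \<delta> d\<close>,
  where \<open>d\<close> is the difference of two unit vectors in the support, so that \<open>\<theta>\<close> and \<open>\<phi>\<close> have the same
  coordinate sum and their orbits are at distance at least \<open>\<delta>\<close>. Subtracting the common mean and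
  rescaling by \<open>\<sigma>\<close> turns the laws into mixtures with densities \<open>F\<^sub>u\<close>, \<open>F\<^sub>v\<close> with respect to the
  standard Gaussian, where \<open>u\<close> and \<open>v\<close> have sum zero. Jensen gives \<open>F\<^sub>u \<ge> exp (- |u|\<^sup>2 / 2)\<close>, hence the
  chi-square divergence is at most a constant times \<open>\<integral> (F\<^sub>u - F\<^sub>v)\<^sup>2\<close>, a second difference of the kernel
  \<open>K u v = avg\<^sub>l exp (u \<bullet> S\<^sub>l v)\<close>, with \<open>S\<^sub>l\<close> the shift by \<open>l\<close>. Its first-order part averages to
  zero over the shifts because the sums agree, which leaves
  \<open>O(|u|\<^sup>2 |v - u|\<^sup>2) = O(\<delta>\<^sup>2 / \<sigma>\<^sup>4)\<close>. With \<open>\<delta>\<close> of order \<open>min (\<sigma>\<^sup>2 / sqrt n) 1\<close>, the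
  divergence between the laws of \<open>n\<close> samples stays bounded.
\<close>

section \<open>Cyclic shifts and orbit mixtures of Gaussians\<close>

lemma cyclic_shift_nth: "cyclic_shift l x $ i = x $ (i + l)"
  by (simp add: cyclic_shift_def)

lemma cyclic_shift_add: "cyclic_shift l (x + y) = cyclic_shift l x + cyclic_shift l y"
  by (simp add: vec_eq_iff cyclic_shift_nth)

lemma cyclic_shift_cyclic_shift: "cyclic_shift k (cyclic_shift l x) = cyclic_shift (k + l) x"
  by (simp add: vec_eq_iff cyclic_shift_nth ac_simps)

lemma sum_translate:
  fixes f :: "'a::{finite, ab_group_add} \<Rightarrow> 'b::comm_monoid_add"
  shows "(\<Sum>i\<in>UNIV. f (i + l)) = (\<Sum>i\<in>UNIV. f i)"
  by (rule sum.reindex_bij_witness[where i = "\<lambda>i. i - l" and j = "\<lambda>i. i + l"]) auto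

lemma sum_translate':
  fixes f :: "'a::{finite, ab_group_add} \<Rightarrow> 'b::comm_monoid_add"
  shows "(\<Sum>i\<in>UNIV. f (l + i)) = (\<Sum>i\<in>UNIV. f i)"
  using sum_translate[of f l] by (simp add: add.commute)

lemma inner_cyclic_shift: "cyclic_shift l x \<bullet> cyclic_shift l y = x \<bullet> y"
  unfolding inner_vec_def cyclic_shift_nth
  by (rule sum_translate[where f = "\<lambda>i. x $ i \<bullet> y $ i"])

lemma norm_cyclic_shift: "norm (cyclic_shift l x) = norm x"
  by (simp add: norm_eq_sqrt_inner inner_cyclic_shift)

text \<open>Shifts are isometries, so an inner product between two orbits depends only on the
  relative shift \<open>l - k\<close>. This collapses double averages over shifts to single
  ones.\<close>

lemma inner_cyclic_shift_left: "cyclic_shift k x \<bullet> cyclic_shift l y = x \<bullet> cyclic_shift (l - k) y"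
  using inner_cyclic_shift[of k x "cyclic_shift (l - k) y"]
  by (simp add: cyclic_shift_cyclic_shift)

text \<open>Every entry of \<open>x\<close> passes once through each coordinate. An orbit of a
  vector with coordinate sum zero therefore sums to zero, which is how terms linear in a shifted
  vector cancel below.\<close>

lemma sum_cyclic_shift: "(\<Sum>l\<in>UNIV. cyclic_shift l x) = (\<chi> i. \<Sum>j\<in>UNIV. x $ j)"
  by (simp add: vec_eq_iff cyclic_shift_nth sum_translate')

text \<open>A unit vector tells any two shifts apart as maps, even though they may agree on a
  periodic signal. Hence a uniform draw from the set \<open>cyclic_shifts\<close> amounts to a
  uniform residue.\<close>

lemma inj_cyclic_shift: "inj (cyclic_shift :: 'l::finite mod_ring \<Rightarrow> _)"
proof (rule injI)
  fix k l :: "'l mod_ring"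
  assume *: "cyclic_shift k = cyclic_shift l"
  have "cyclic_shift k (axis 0 1 :: 'l signal) $ (- k) = 1"
    by (simp add: cyclic_shift_nth axis_def)
  with * have "cyclic_shift l (axis 0 1 :: 'l signal) $ (- k) = 1" by simp
  then show "k = l" by (simp add: cyclic_shift_nth axis_def split: if_splits)
qed

section \<open>The standard Gaussian measure under translation\<close>

lemma sets_std_gaussian [measurable_cong, simp]: "sets std_gaussian = sets borel"
  by (simp add: std_gaussian_def)

lemma space_std_gaussian [simp]: "space std_gaussian = UNIV"
  by (simp add: std_gaussian_def)

lemma std_gaussian_density_measurable [measurable]:
  "(\<lambda>x :: 'l::finite signal. \<Prod>i\<in>UNIV. std_normal_density (x $ i)) \<in> borel_measurable borel"
  by measurable

lemma std_gaussian_density_translate: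
  fixes a x :: "'l::finite signal"
  shows "(\<Prod>i\<in>UNIV. std_normal_density ((x - a) $ i)) =
    (\<Prod>i\<in>UNIV. std_normal_density (x $ i)) * exp (x \<bullet> a - (a \<bullet> a) / 2)"
proof -
  have "std_normal_density (s - t) = std_normal_density s * exp (s * t - t * t / 2)" for s t :: real
    by (simp add: std_normal_density_def exp_add[symmetric] power2_eq_square field_simps)
  then show ?thesis
    by (simp add: prod.distrib exp_sum[symmetric] inner_vec_def sum_subtractf sum_divide_distrib)
qed

text \<open>The Cameron-Martin formula: Lebesgue measure is translation invariant, and completing
  the square turns the translated density into the original one times an exponential weight.\<close>

lemma nn_integral_std_gaussian_translate:
  fixes a :: "'l::finite signal"
  assumes [measurable]: "h \<in> borel_measurable borel"
  shows "(\<integral>\<^sup>+ x. h (x + a) \<partial>std_gaussian) =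
    (\<integral>\<^sup>+ x. ennreal (exp (x \<bullet> a - (a \<bullet> a) / 2)) * h x \<partial>std_gaussian)"
proof -
  let ?g = "\<lambda>x :: 'l signal. \<Prod>i\<in>UNIV. std_normal_density (x $ i)"
  have g: "?g x \<ge> 0" for x by (simp add: prod_nonneg)
  have "(\<integral>\<^sup>+ x. h (x + a) \<partial>std_gaussian) = (\<integral>\<^sup>+ x. ennreal (?g x) * h (x + a) \<partial>lborel)"
    unfolding std_gaussian_def by (subst nn_integral_density) auto
  also have "\<dots> = (\<integral>\<^sup>+ x. ennreal (?g (a + x - a)) * h (a + x) \<partial>lborel)"
    by (simp add: add.commute)
  also have "\<dots> = (\<integral>\<^sup>+ x. ennreal (?g (x - a)) * h x \<partial>distr lborel borel ((+) a))"
    by (subst nn_integral_distr) auto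
  also have "\<dots> = (\<integral>\<^sup>+ x. ennreal (?g x) * (ennreal (exp (x \<bullet> a - (a \<bullet> a) / 2)) * h x) \<partial>lborel)"
    unfolding lborel_distr_plus std_gaussian_density_translate
    by (simp add: ennreal_mult g mult.assoc)
  also have "\<dots> = (\<integral>\<^sup>+ x. ennreal (exp (x \<bullet> a - (a \<bullet> a) / 2)) * h x \<partial>std_gaussian)"
    unfolding std_gaussian_def by (subst nn_integral_density) auto
  finally show ?thesis .
qed

lemma prob_space_std_gaussian: "prob_space (std_gaussian :: 'l::finite signal measure)"
proof (rule prob_spaceI)
  have "(\<integral>\<^sup>+ x. ennreal (\<Prod>b\<in>Basis. std_normal_density (x \<bullet> b)) \<partial>(lborel :: 'l signal measure))
      = (\<integral>\<^sup>+ x. (\<Prod>b\<in>Basis. ennreal (std_normal_density (x \<bullet> b))) \<partial>(lborel :: 'l signal measure))"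
    by (simp add: prod_ennreal)
  also have "\<dots> = (\<Prod>b\<in>(Basis :: 'l signal set). \<integral>\<^sup>+ t. ennreal (std_normal_density t) \<partial>lborel)"
    by (rule nn_integral_lborel_prod) auto
  also have "(\<integral>\<^sup>+ t. ennreal (std_normal_density t) \<partial>lborel) = 1"
    by (simp add: nn_integral_eq_integral)
  finally have *: "(\<integral>\<^sup>+ x. ennreal (\<Prod>b\<in>Basis. std_normal_density (x \<bullet> b)) \<partial>(lborel :: 'l signal measure)) = 1"
    by simp
  \<comment> \<open>The integral was factored along \<open>Basis\<close>, which for these vectors
    consists of the unit axes, one per coordinate.\<close>
  have "(\<Prod>b\<in>Basis. std_normal_density (x \<bullet> b)) = (\<Prod>i\<in>UNIV. std_normal_density (x $ i))"
    for x :: "'l signal"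
  proof -
    have B: "(Basis :: 'l signal set) = (\<lambda>i. axis i 1) ` UNIV"
      by (auto simp: Basis_vec_def)
    show ?thesis
      unfolding B by (subst prod.reindex) (auto simp: inj_on_def axis_eq_axis inner_axis)
  qed
  with * show "emeasure std_gaussian (space (std_gaussian :: 'l signal measure)) = 1"
    by (simp add: std_gaussian_def emeasure_density)
qed

text \<open>The moment generating function. The Cameron-Martin weight differs from
  \<open>exp (x \<bullet> a)\<close> by the factor \<open>exp ((a \<bullet> a) / 2)\<close>, so the
  translation formula applied to that constant evaluates the integral.\<close>

lemma
  fixes a :: "'l::finite signal"
  shows integrable_exp_inner_std_gaussian: "integrable std_gaussian (\<lambda>x. exp (x \<bullet> a))"
    and integral_exp_inner_std_gaussian: "(\<integral>x. exp (x \<bullet> a) \<partial>std_gaussian) = exp ((a \<bullet> a) / 2)"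
proof -
  interpret prob_space "std_gaussian :: 'l signal measure" by (rule prob_space_std_gaussian)
  let ?c = "exp ((a \<bullet> a) / 2)"
  have "(\<integral>\<^sup>+ x. ennreal (exp (x \<bullet> a)) \<partial>std_gaussian)
      = (\<integral>\<^sup>+ x. ennreal (exp (x \<bullet> a - (a \<bullet> a) / 2)) * ennreal ?c \<partial>std_gaussian)"
    by (simp add: ennreal_mult[symmetric] exp_add[symmetric])
  also have "\<dots> = (\<integral>\<^sup>+ x. ennreal ?c \<partial>(std_gaussian :: 'l signal measure))"
    by (rule nn_integral_std_gaussian_translate[symmetric]) auto
  also have "\<dots> = ennreal ?c"
    by (simp add: emeasure_space_1[simplified])
  finally have *: "(\<integral>\<^sup>+ x. ennreal (exp (x \<bullet> a)) \<partial>std_gaussian) = ennreal ?c" .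
  show "integrable std_gaussian (\<lambda>x. exp (x \<bullet> a))"
    by (rule integrableI_nn_integral_finite[OF _ _ *]) auto
  show "(\<integral>x. exp (x \<bullet> a) \<partial>std_gaussian) = exp ((a \<bullet> a) / 2)"
    using * by (intro integral_eq_nn_integral[THEN trans]) auto
qed

text \<open>The density of \<open>cyclic_shift l u + \<xi>\<close>, for uniform \<open>l\<close> and standard Gaussian \<open>\<xi>\<close>, with respect
  to \<open>std_gaussian\<close>.\<close>

definition orbit_density :: "'l::finite signal \<Rightarrow> 'l signal \<Rightarrow> real" where
  "orbit_density u x = (\<Sum>l\<in>UNIV. exp (x \<bullet> cyclic_shift l u - (u \<bullet> u) / 2)) / real CARD('l)"

text \<open>This will be the inner product of two orbit densities in the L2 space of the standard
  Gaussian.\<close>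

definition orbit_kernel :: "'l::finite signal \<Rightarrow> 'l signal \<Rightarrow> real" where
  "orbit_kernel u v = (\<Sum>l\<in>UNIV. exp (u \<bullet> cyclic_shift l v)) / real CARD('l)"

section \<open>Mass, inner products and chi-square divergence of orbit densities\<close>

lemma measurable_orbit_density [measurable]: "orbit_density u \<in> borel_measurable borel"
  unfolding orbit_density_def by measurable

lemma orbit_density_pos: "0 < orbit_density u x"
  unfolding orbit_density_def by (intro divide_pos_pos sum_pos) auto

text \<open>Jensen's inequality in the form \<open>1 + t \<le> exp t\<close>, averaged over the
  shifts; the linear terms add up to zero. The bound is uniform in \<open>x\<close>, so dividing by
  \<open>orbit_density u\<close> costs only a constant factor in the chi-square integral.\<close>

lemma orbit_density_ge:
  fixes u x :: "'l::finite signal"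
  assumes "(\<Sum>i\<in>UNIV. u $ i) = 0"
  shows "exp (- (u \<bullet> u) / 2) \<le> orbit_density u x"
proof -
  have "(\<Sum>l\<in>UNIV. x \<bullet> cyclic_shift l u) = x \<bullet> (\<Sum>l\<in>UNIV. cyclic_shift l u)"
    by (rule inner_sum_right[symmetric])
  also have "\<dots> = 0"
    unfolding sum_cyclic_shift assms by (simp add: inner_vec_def)
  finally have "(\<Sum>l\<in>UNIV. x \<bullet> cyclic_shift l u) = 0" .
  then have "real CARD('l) = (\<Sum>l\<in>UNIV. 1 + x \<bullet> cyclic_shift l u)"
    by (simp add: sum.distrib)
  also have "\<dots> \<le> (\<Sum>l\<in>UNIV. exp (x \<bullet> cyclic_shift l u))"
    by (intro sum_mono exp_ge_add_one_self)
  finally have "1 \<le> (\<Sum>l\<in>UNIV. exp (x \<bullet> cyclic_shift l u)) / real CARD('l)"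
    by (simp add: field_simps)
  then have "exp (- (u \<bullet> u) / 2) * 1 \<le>
      exp (- (u \<bullet> u) / 2) * ((\<Sum>l\<in>UNIV. exp (x \<bullet> cyclic_shift l u)) / real CARD('l))"
    by (intro mult_left_mono) auto
  also have "\<dots> = orbit_density u x"
    by (simp add: orbit_density_def diff_conv_add_uminus exp_add sum_distrib_right[symmetric] mult.commute
        del: add_uminus_conv_diff)
  finally show ?thesis by simp
qed

lemma
  fixes u :: "'l::finite signal"
  shows integrable_orbit_density: "integrable std_gaussian (orbit_density u)"
    and integral_orbit_density: "(\<integral>x. orbit_density u x \<partial>std_gaussian) = 1"
proof -
  have eq: "orbit_density u = (\<lambda>x. \<Sum>l\<in>UNIV. exp (x \<bullet> cyclic_shift l u) * (exp (- (u \<bullet> u) / 2) / real CARD('l)))"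
    by (rule ext) (simp add: orbit_density_def diff_conv_add_uminus exp_add sum_divide_distrib
        del: add_uminus_conv_diff)
  show "integrable std_gaussian (orbit_density u)"
    unfolding eq by (intro Bochner_Integration.integrable_sum integrable_mult_left integrable_exp_inner_std_gaussian)
  show "(\<integral>x. orbit_density u x \<partial>std_gaussian) = 1"
    unfolding eq
    by (simp add: Bochner_Integration.integral_sum integrable_mult_left integrable_exp_inner_std_gaussian
        integral_exp_inner_std_gaussian inner_cyclic_shift exp_minus)
qed

text \<open>Multiplying out gives Gaussian moments at
  \<open>cyclic_shift k u + cyclic_shift l v\<close>. The normalisation cancels everything in half
  the squared norm except the cross term, which depends on \<open>l - k\<close> only, and the sum
  over \<open>k\<close> contributes a factor \<open>CARD('l)\<close>.\<close>

lemma
  fixes u v :: "'l::finite signal"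
  shows integrable_orbit_density_mult: 
      "integrable std_gaussian (\<lambda>x. orbit_density u x * orbit_density v x)"
    and integral_orbit_density_mult:
      "(\<integral>x. orbit_density u x * orbit_density v x \<partial>std_gaussian) = orbit_kernel u v"
proof -
  let ?L = "real CARD('l)"
  let ?c = "exp (- (u \<bullet> u + v \<bullet> v) / 2) / ?L^2"
  have eq: "(\<lambda>x. orbit_density u x * orbit_density v x) =
     (\<lambda>x. \<Sum>k\<in>UNIV. \<Sum>l\<in>UNIV. exp (x \<bullet> (cyclic_shift k u + cyclic_shift l v)) * ?c)"
    by (rule ext) (simp add: orbit_density_def sum_product sum_divide_distrib inner_add_right
        power2_eq_square exp_add[symmetric] algebra_simps add_divide_distrib diff_divide_distrib)
  show "integrable std_gaussian (\<lambda>x. orbit_density u x * orbit_density v x)"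
    unfolding eq by (intro Bochner_Integration.integrable_sum integrable_mult_left integrable_exp_inner_std_gaussian)
  have e: "exp ((cyclic_shift k u + cyclic_shift l v) \<bullet> (cyclic_shift k u + cyclic_shift l v) / 2) * ?c
     = exp (u \<bullet> cyclic_shift (l - k) v) / ?L^2" for k l
  proof -
    have "(cyclic_shift k u + cyclic_shift l v) \<bullet> (cyclic_shift k u + cyclic_shift l v) / 2
      = u \<bullet> cyclic_shift (l - k) v + (u \<bullet> u + v \<bullet> v) / 2"
      unfolding inner_cyclic_shift_left[symmetric]
      by (simp add: inner_add_left inner_add_right inner_cyclic_shift
          inner_commute[of "cyclic_shift l v" "cyclic_shift k u"] field_simps)
    then show ?thesis by (simp add: mult_exp_exp add_divide_distrib diff_divide_distrib)
  qed
  have "(\<integral>x. orbit_density u x * orbit_density v x \<partial>std_gaussian) =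
     (\<Sum>k\<in>UNIV. \<Sum>l\<in>UNIV. exp ((cyclic_shift k u + cyclic_shift l v) \<bullet>
        (cyclic_shift k u + cyclic_shift l v) / 2) * ?c)"
    unfolding eq
    by (simp add: Bochner_Integration.integral_sum integrable_mult_left integrable_exp_inner_std_gaussian
        integral_exp_inner_std_gaussian Bochner_Integration.integrable_sum del: times_divide_eq_right)
  also have "\<dots> = (\<Sum>k\<in>UNIV. \<Sum>l\<in>UNIV. exp (u \<bullet> cyclic_shift (l - k) v) / ?L^2)"
    by (simp only: e)
  also have "\<dots> = (\<Sum>k\<in>(UNIV::'l mod_ring set). \<Sum>l\<in>UNIV. exp (u \<bullet> cyclic_shift l v) / ?L^2)"
    using sum_translate[of "\<lambda>l. exp (u \<bullet> cyclic_shift l v) / ?L^2" "- k" for k] by simp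
  also have "\<dots> = orbit_kernel u v"
    by (simp add: orbit_kernel_def sum_divide_distrib[symmetric] power2_eq_square)
  finally show "(\<integral>x. orbit_density u x * orbit_density v x \<partial>std_gaussian) = orbit_kernel u v" .
qed

text \<open>With \<open>f\<close> and \<open>g\<close> the densities of \<open>u\<close> and
  \<open>v\<close>, \<open>g^2 / f = 2 * g - f + (f - g)^2 / f\<close>, and \<open>1 / f\<close> is
  at most \<open>exp ((u \<bullet> u) / 2)\<close>. Integration turns \<open>2 * g - f\<close> into
  1 and the expanded square into kernel values.\<close>

lemma chi_square_orbit_density_le:
  fixes u v :: "'l::finite signal"
  assumes "(\<Sum>i\<in>UNIV. u $ i) = 0"
  shows "(\<integral>\<^sup>+ x. ennreal ((orbit_density v x)\<^sup>2 / orbit_density u x) \<partial>std_gaussian)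
     \<le> ennreal (1 + exp ((u \<bullet> u) / 2) * (orbit_kernel u u - 2 * orbit_kernel u v + orbit_kernel v v))"
proof -
  let ?e = "exp ((u \<bullet> u) / 2)"
  let ?f = "orbit_density u" and ?g = "orbit_density v"
  let ?h = "\<lambda>x. 2 * ?g x - ?f x + ?e * (?f x * ?f x - 2 * (?f x * ?g x) + ?g x * ?g x)"
  have *: "(?g x)\<^sup>2 / ?f x \<le> ?h x" for x
  proof -
    have f: "?f x > 0" by (rule orbit_density_pos)
    have "1 / ?f x \<le> ?e"
      using orbit_density_ge[OF assms, of x] f by (simp add: exp_minus field_simps)
    then have "(?f x - ?g x)\<^sup>2 * (1 / ?f x) \<le> (?f x - ?g x)\<^sup>2 * ?e"
      by (intro mult_left_mono) auto
    moreover have "(?g x)\<^sup>2 / ?f x = 2 * ?g x - ?f x + (?f x - ?g x)\<^sup>2 * (1 / ?f x)"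
      using f by (simp add: field_simps power2_eq_square)
    ultimately show ?thesis by (simp add: power2_eq_square algebra_simps)
  qed
  have i: "integrable std_gaussian ?h"
    by (intro Bochner_Integration.integrable_add Bochner_Integration.integrable_diff integrable_mult_right
       integrable_orbit_density integrable_orbit_density_mult)
  have "?h x \<ge> 0" for x
    using * [of x] orbit_density_pos[of u x] by (smt (verit) divide_nonneg_pos zero_le_power2)
  then have "(\<integral>\<^sup>+ x. ennreal (?h x) \<partial>std_gaussian) = ennreal (\<integral>x. ?h x \<partial>std_gaussian)"
    by (intro nn_integral_eq_integral i) auto
  also have "(\<integral>x. ?h x \<partial>std_gaussian) = 
     1 + ?e * (orbit_kernel u u - 2 * orbit_kernel u v + orbit_kernel v v)"
    by (simp add: integrable_orbit_density integrable_orbit_density_mult integral_orbit_density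
       integral_orbit_density_mult)
  finally show ?thesis
    using * by (metis (no_types, lifting) ennreal_leI nn_integral_mono)
qed

section \<open>Second differences of the orbit kernel\<close>

lemma exp_minus_one_abs_le:
  fixes t b :: real
  assumes "\<bar>t\<bar> \<le> b"
  shows "\<bar>exp t - 1\<bar> \<le> \<bar>t\<bar> * exp b"
proof (cases "t \<ge> 0")
  case True
  have "1 - t \<le> exp (- t)" using exp_ge_add_one_self[of "- t"] by simp
  then have "(1 - t) * exp t \<le> exp (- t) * exp t" by (intro mult_right_mono) auto
  then have "exp t - 1 \<le> t * exp t" by (simp add: algebra_simps exp_add[symmetric])
  also have "\<dots> \<le> t * exp b" using assms True by (intro mult_left_mono) auto
  finally show ?thesis using True by simp
next
  case False
  have "1 + t \<le> exp t" by (rule exp_ge_add_one_self)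
  moreover have "exp t \<le> 1" using False by simp
  ultimately have "\<bar>exp t - 1\<bar> \<le> \<bar>t\<bar> * 1" using False by linarith
  also have "\<dots> \<le> \<bar>t\<bar> * exp b" using assms by (intro mult_left_mono) auto
  finally show ?thesis .
qed

text \<open>From \<open>(1 - t) * exp t \<le> 1\<close> follows
  \<open>exp t - 1 - t \<le> t * (exp t - 1)\<close>, which reduces the second-order remainder to
  the first-order bound.\<close>

lemma exp_second_order_le:
  fixes t b :: real
  assumes "\<bar>t\<bar> \<le> b"
  shows "exp t - 1 - t \<le> t\<^sup>2 * exp b"
proof -
  have "1 - t \<le> exp (- t)" using exp_ge_add_one_self[of "- t"] by simp
  then have "(1 - t) * exp t \<le> exp (- t) * exp t" by (intro mult_right_mono) auto
  then have "exp t - 1 - t \<le> t * (exp t - 1)" by (simp add: algebra_simps exp_add[symmetric])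
  also have "\<dots> \<le> \<bar>t\<bar> * \<bar>exp t - 1\<bar>" by (metis abs_ge_self abs_mult)
  also have "\<dots> \<le> \<bar>t\<bar> * (\<bar>t\<bar> * exp b)"
    by (intro mult_left_mono exp_minus_one_abs_le assms) auto
  finally show ?thesis by (simp add: power2_eq_square)
qed

text \<open>In the application \<open>a\<close>, \<open>x\<close>, \<open>y\<close>,
  \<open>z\<close> are the inner products of \<open>u\<close> or \<open>w\<close> with a shift of
  \<open>u\<close> or \<open>w\<close>, \<open>r\<close> is the norm of \<open>w\<close>, and
  \<open>b\<close> bounds both norms. The term \<open>z\<close> is kept exact: it alone is of order
  \<open>r^2\<close> without a factor \<open>b^2\<close>, and it must cancel later in the average
  over shifts.\<close>

lemma exp_mixed_difference_le:
  fixes a x y z b r :: real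
  assumes a: "\<bar>a\<bar> \<le> b\<^sup>2" and x: "\<bar>x\<bar> \<le> b * r" and y: "\<bar>y\<bar> \<le> b * r" and z: "\<bar>z\<bar> \<le> r\<^sup>2"
    and r: "0 \<le> r" "r \<le> b"
  shows "exp a - exp (a + x) - exp (a + y) + exp (a + x + y + z) \<le> z + 5 * exp (4 * b\<^sup>2) * b\<^sup>2 * r\<^sup>2"
proof -
  define E where "E = exp (b\<^sup>2)"
  have E1: "1 \<le> E" by (simp add: E_def)
  have E4: "E ^ 4 = exp (4 * b\<^sup>2)" by (simp add: E_def exp_of_nat_mult[symmetric])
  have brb: "b * r \<le> b\<^sup>2" using r by (simp add: power2_eq_square mult_left_mono)
  have rrb: "r\<^sup>2 \<le> b\<^sup>2" using r by (simp add: power_mono)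
  have lin: "\<bar>exp t - 1\<bar> \<le> c * E" if "\<bar>t\<bar> \<le> c" "c \<le> b\<^sup>2" for t c
  proof -
    have "\<bar>exp t - 1\<bar> \<le> \<bar>t\<bar> * E" unfolding E_def by (rule exp_minus_one_abs_le) (use that in simp)
    also have "\<dots> \<le> c * E" using that E1 by (intro mult_right_mono) auto
    finally show ?thesis .
  qed
  have "exp a * ((exp x - 1) * (exp y - 1)) \<le> \<bar>exp a\<bar> * (\<bar>exp x - 1\<bar> * \<bar>exp y - 1\<bar>)"
    by (metis abs_ge_self abs_mult)
  also have "\<dots> \<le> E * ((b * r * E) * (b * r * E))"
    using a lin[OF x brb] lin[OF y brb] r E1 by (intro mult_mono) (auto simp: E_def)
  also have "\<dots> = E ^ 3 * (b\<^sup>2 * r\<^sup>2)" by (simp add: power2_eq_square power3_eq_cube)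
  also have "\<dots> \<le> E ^ 4 * (b\<^sup>2 * r\<^sup>2)"
    using E1 by (intro mult_right_mono power_increasing) auto
  finally have T1: "exp a * ((exp x - 1) * (exp y - 1)) \<le> E ^ 4 * (b\<^sup>2 * r\<^sup>2)" .
  have axy: "\<bar>a + x + y\<bar> \<le> 3 * b\<^sup>2" using a x y brb by linarith
  have "(exp z - 1) * (exp (a + x + y) - 1) \<le> \<bar>exp z - 1\<bar> * \<bar>exp (a + x + y) - 1\<bar>"
    by (metis abs_ge_self abs_mult)
  also have "\<dots> \<le> (r\<^sup>2 * E) * (3 * b\<^sup>2 * E ^ 3)"
  proof (intro mult_mono lin z rrb)
    have "\<bar>exp (a + x + y) - 1\<bar> \<le> \<bar>a + x + y\<bar> * exp (3 * b\<^sup>2)"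
      by (rule exp_minus_one_abs_le[OF axy])
    also have "\<dots> \<le> 3 * b\<^sup>2 * exp (3 * b\<^sup>2)" using axy by (intro mult_right_mono) auto
    finally show "\<bar>exp (a + x + y) - 1\<bar> \<le> 3 * b\<^sup>2 * E ^ 3"
      by (simp add: E_def exp_of_nat_mult[symmetric])
  qed (use E1 in auto)
  also have "\<dots> = 3 * (E ^ 4 * (b\<^sup>2 * r\<^sup>2))" by (simp add: power_def numeral_eq_Suc)
  finally have T2: "(exp z - 1) * (exp (a + x + y) - 1) \<le> 3 * (E ^ 4 * (b\<^sup>2 * r\<^sup>2))" .
  have "exp z - 1 - z \<le> z\<^sup>2 * E"
    unfolding E_def by (rule exp_second_order_le) (use z rrb in simp)
  also have "\<dots> \<le> (b\<^sup>2 * r\<^sup>2) * E"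
  proof (intro mult_right_mono)
    have "z\<^sup>2 \<le> (r\<^sup>2)\<^sup>2" using power_mono[OF z, of 2] by simp
    also have "\<dots> \<le> b\<^sup>2 * r\<^sup>2" using rrb by (simp add: power2_eq_square mult_right_mono)
    finally show "z\<^sup>2 \<le> b\<^sup>2 * r\<^sup>2" .
  qed (use E1 in auto)
  also have "\<dots> \<le> (b\<^sup>2 * r\<^sup>2) * E ^ 4"
    using E1 power_increasing[of 1 4 E] by (intro mult_left_mono) auto
  finally have T3: "exp z - 1 - z \<le> E ^ 4 * (b\<^sup>2 * r\<^sup>2)" by (simp add: mult.commute)
  \<comment> \<open>An exact decomposition. The three remainders contribute 1, 3 and 1 times
    \<open>E ^ 4 * (b^2 * r^2)\<close>, whence the constant 5; the 3 comes from the bound on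
    \<open>a + x + y\<close>.\<close>
  have "exp a - exp (a + x) - exp (a + y) + exp (a + x + y + z) =
      exp a * ((exp x - 1) * (exp y - 1)) + (exp z - 1) * (exp (a + x + y) - 1) + (exp z - 1 - z) + z"
    by (simp add: exp_add algebra_simps)
  also have "\<dots> \<le> z + 5 * (E ^ 4 * (b\<^sup>2 * r\<^sup>2))" using T1 T2 T3 by simp
  finally show ?thesis by (simp add: E4 mult.assoc)
qed

lemma orbit_kernel_commute: "orbit_kernel u v = orbit_kernel v u"
  unfolding integral_orbit_density_mult[symmetric] by (simp add: mult.commute)

text \<open>The left side is the squared L2 distance of the two orbit densities. The
  mixed-difference bound is applied shift by shift, and its exact part vanishes on
  summation.\<close>

lemma orbit_kernel_difference_le:
  fixes u w :: "'l::finite signal"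
  assumes w0: "(\<Sum>i\<in>UNIV. w $ i) = 0" and u: "norm u \<le> b" and w: "norm w \<le> b"
  shows "orbit_kernel u u - 2 * orbit_kernel u (u + w) + orbit_kernel (u + w) (u + w)
    \<le> 5 * exp (4 * b\<^sup>2) * b\<^sup>2 * (norm w)\<^sup>2"
proof -
  let ?L = "real CARD('l)" and ?S = "cyclic_shift :: 'l mod_ring \<Rightarrow> _"
  let ?c = "5 * exp (4 * b\<^sup>2) * b\<^sup>2 * (norm w)\<^sup>2"
  have b: "0 \<le> b" using u norm_ge_zero order_trans by blast
  have cs: "\<bar>p \<bullet> ?S l q\<bar> \<le> norm p * norm q" for p q l
    using Cauchy_Schwarz_ineq2[of p "?S l q"] by (simp add: norm_cyclic_shift)
  \<comment> \<open>Symmetry of the kernel splits the doubled cross term in two, so that each shift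
    contributes one mixed second difference.\<close>
  have "?L * (orbit_kernel u u - 2 * orbit_kernel u (u + w) + orbit_kernel (u + w) (u + w)) =
     ?L * (orbit_kernel u u - orbit_kernel u (u + w) - orbit_kernel (u + w) u + orbit_kernel (u + w) (u + w))"
    by (simp add: orbit_kernel_commute[of "u + w" u])
  also have "\<dots> = (\<Sum>l\<in>UNIV. exp (u \<bullet> ?S l u) - exp (u \<bullet> ?S l u + u \<bullet> ?S l w)
      - exp (u \<bullet> ?S l u + w \<bullet> ?S l u) + exp (u \<bullet> ?S l u + u \<bullet> ?S l w + w \<bullet> ?S l u + w \<bullet> ?S l w))"
    by (simp add: orbit_kernel_def sum.distrib sum_subtractf inner_add_left inner_add_right
        cyclic_shift_add algebra_simps)
  also have "\<dots> \<le> (\<Sum>l\<in>UNIV. w \<bullet> ?S l w + ?c)"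
  proof (intro sum_mono exp_mixed_difference_le)
    fix l
    have "norm u * norm u \<le> b * b" "norm u * norm w \<le> b * norm w"
      using u w b by (auto intro!: mult_mono)
    then show "\<bar>u \<bullet> ?S l u\<bar> \<le> b\<^sup>2" "\<bar>u \<bullet> ?S l w\<bar> \<le> b * norm w" "\<bar>w \<bullet> ?S l u\<bar> \<le> b * norm w"
      using cs[of u l u] cs[of u l w] cs[of w l u] by (auto simp: power2_eq_square mult.commute)
    show "\<bar>w \<bullet> ?S l w\<bar> \<le> (norm w)\<^sup>2" using cs[of w l w] by (simp add: power2_eq_square)
  qed (use w in auto)
  also have "\<dots> = w \<bullet> (\<Sum>l\<in>UNIV. ?S l w) + ?L * ?c"
    by (simp add: sum.distrib inner_sum_right)
  also have "w \<bullet> (\<Sum>l\<in>UNIV. ?S l w) = 0"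
    unfolding sum_cyclic_shift w0 by (simp add: inner_vec_def)
  finally show ?thesis by simp
qed

section \<open>Two-point lower bounds\<close>

text \<open>Le Cam's bound, with \<open>a\<close> and \<open>b\<close> the losses at the two
  parameters. The common mass of the two laws is the integral of \<open>min 1 \<Lambda>\<close>; a
  second moment of at most 2 makes it at least \<open>1 - 2 / 4\<close>.\<close>

lemma chi_square_two_point:
  fixes a b :: "'a \<Rightarrow> ennreal" and \<Lambda> :: "'a \<Rightarrow> real" and \<delta> :: real
  assumes [measurable]: "a \<in> borel_measurable P" "b \<in> borel_measurable P" "\<Lambda> \<in> borel_measurable P"
    and \<Lambda>: "\<And>x. 0 \<le> \<Lambda> x" and "0 \<le> \<delta>"
    and one: "(\<integral>\<^sup>+ x. ennreal (\<Lambda> x) \<partial>P) = 1"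
    and two: "(\<integral>\<^sup>+ x. ennreal ((\<Lambda> x)\<^sup>2) \<partial>P) \<le> 2"
    and sep: "\<And>x. ennreal \<delta> \<le> a x + b x"
  shows "ennreal (\<delta> / 2) \<le> (\<integral>\<^sup>+ x. a x \<partial>P) + (\<integral>\<^sup>+ x. b x \<partial>density P (\<lambda>x. ennreal (\<Lambda> x)))"
proof -
  \<comment> \<open>pointwise, \<open>min 1 \<Lambda> \<ge> \<Lambda> - \<Lambda>\<^sup>2 / 4\<close>, because \<open>(1 - \<Lambda> / 2)\<^sup>2 \<ge> 0\<close>\<close>
  have pt: "ennreal \<delta> * ennreal (\<Lambda> x) \<le> a x + ennreal (\<Lambda> x) * b x + ennreal (\<delta> / 4) * ennreal ((\<Lambda> x)\<^sup>2)"
    for x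
  proof -
    have "min 1 (\<Lambda> x) * \<delta> + \<delta> / 4 * (\<Lambda> x)\<^sup>2 \<ge> \<delta> * \<Lambda> x"
    proof (cases "\<Lambda> x \<le> 1")
      case True
      then show ?thesis using \<open>0 \<le> \<delta>\<close> by (simp add: min_def mult.commute)
    next
      case False
      have "0 \<le> \<delta> * (1 - \<Lambda> x / 2)\<^sup>2" using \<open>0 \<le> \<delta>\<close> by simp
      then show ?thesis using False by (simp add: min_def power2_eq_square algebra_simps)
    qed
    then have "ennreal (\<delta> * \<Lambda> x) \<le> ennreal (min 1 (\<Lambda> x) * \<delta> + \<delta> / 4 * (\<Lambda> x)\<^sup>2)"
      by (rule ennreal_leI)
    also have "\<dots> = ennreal (min 1 (\<Lambda> x)) * ennreal \<delta> + ennreal (\<delta> / 4) * ennreal ((\<Lambda> x)\<^sup>2)"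
      using \<Lambda>[of x] \<open>0 \<le> \<delta>\<close> by (simp add: ennreal_mult[symmetric] ennreal_plus[symmetric] del: ennreal_plus)
    also have "ennreal (min 1 (\<Lambda> x)) * ennreal \<delta> \<le> ennreal (min 1 (\<Lambda> x)) * (a x + b x)"
      by (intro mult_left_mono sep) auto
    also have "\<dots> \<le> 1 * a x + ennreal (\<Lambda> x) * b x"
      unfolding distrib_left
      by (intro add_mono mult_right_mono) (auto simp: ennreal_le_1 intro!: ennreal_leI)
    finally show ?thesis using \<Lambda>[of x] \<open>0 \<le> \<delta>\<close> by (simp add: ennreal_mult add_mono)
  qed
  \<comment> \<open>Subtraction in \<open>ennreal\<close> is avoided: \<open>\<delta>\<close> is
    split into halves, one of which is finally cancelled against the finite second-moment
    term.\<close>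
  have "ennreal (\<delta> / 2) + ennreal (\<delta> / 2) = ennreal \<delta>"
    using \<open>0 \<le> \<delta>\<close> by (subst ennreal_plus[symmetric]) auto
  also have "\<dots> = ennreal \<delta> * (\<integral>\<^sup>+ x. ennreal (\<Lambda> x) \<partial>P)" by (simp add: one)
  also have "\<dots> = (\<integral>\<^sup>+ x. ennreal \<delta> * ennreal (\<Lambda> x) \<partial>P)" by (rule nn_integral_cmult[symmetric]) auto
  also have "\<dots> \<le> (\<integral>\<^sup>+ x. a x + ennreal (\<Lambda> x) * b x + ennreal (\<delta> / 4) * ennreal ((\<Lambda> x)\<^sup>2) \<partial>P)"
    by (intro nn_integral_mono pt)
  also have "\<dots> = (\<integral>\<^sup>+ x. a x \<partial>P) + (\<integral>\<^sup>+ x. ennreal (\<Lambda> x) * b x \<partial>P)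
      + ennreal (\<delta> / 4) * (\<integral>\<^sup>+ x. ennreal ((\<Lambda> x)\<^sup>2) \<partial>P)"
    by (simp add: nn_integral_add nn_integral_cmult)
  also have "\<dots> \<le> (\<integral>\<^sup>+ x. a x \<partial>P) + (\<integral>\<^sup>+ x. ennreal (\<Lambda> x) * b x \<partial>P) + ennreal (\<delta> / 4) * 2"
    by (intro add_left_mono mult_left_mono two) auto
  also have "ennreal (\<delta> / 4) * 2 = ennreal (\<delta> / 2)"
    using \<open>0 \<le> \<delta>\<close> ennreal_mult[of "\<delta> / 4" 2] by simp
  also have "(\<integral>\<^sup>+ x. ennreal (\<Lambda> x) * b x \<partial>P) = (\<integral>\<^sup>+ x. b x \<partial>density P (\<lambda>x. ennreal (\<Lambda> x)))"
    by (rule nn_integral_density[symmetric]) auto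
  finally show ?thesis by (simp add: ennreal_add_left_cancel_le add.commute)
qed

text \<open>The likelihood ratio of independent samples is the product of the single ratios. It
  suffices to compare measures of boxes, where density and indicator both factor over the
  coordinates.\<close>

lemma PiM_density:
  fixes P :: "'a measure" and f :: "'a \<Rightarrow> ennreal"
  assumes "finite I" and P: "prob_space P" and Q: "prob_space (density P f)"
    and [measurable]: "f \<in> borel_measurable P"
  shows "(\<Pi>\<^sub>M i\<in>I. density P f) = density (\<Pi>\<^sub>M i\<in>I. P) (\<lambda>x. \<Prod>i\<in>I. f (x i))"
proof -
  interpret P: prob_space P by fact
  interpret Q: prob_space "density P f" by fact
  interpret P: product_sigma_finite "\<lambda>i. P" by standard
  interpret Q: product_sigma_finite "\<lambda>i. density P f" by standard
  have m: "(\<lambda>x. \<Prod>i\<in>I. f (x i)) \<in> borel_measurable (\<Pi>\<^sub>M i\<in>I. P)"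
    using \<open>finite I\<close> by measurable
  show ?thesis
  proof (rule Q.PiM_eqI[symmetric])
    show "sets (density (\<Pi>\<^sub>M i\<in>I. P) (\<lambda>x. \<Prod>i\<in>I. f (x i))) = sets (\<Pi>\<^sub>M i\<in>I. density P f)"
      by (auto intro!: sets_PiM_cong)
    fix A assume A: "\<And>i. i \<in> I \<Longrightarrow> A i \<in> sets (density P f)"
    then have A': "\<And>i. i \<in> I \<Longrightarrow> A i \<in> sets P" by simp
    have "emeasure (density (\<Pi>\<^sub>M i\<in>I. P) (\<lambda>x. \<Prod>i\<in>I. f (x i))) (Pi\<^sub>E I A)
       = (\<integral>\<^sup>+ x. (\<Prod>i\<in>I. f (x i)) * indicator (Pi\<^sub>E I A) x \<partial>(\<Pi>\<^sub>M i\<in>I. P))"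
      using A' \<open>finite I\<close> m by (intro emeasure_density) auto
    also have "\<dots> = (\<integral>\<^sup>+ x. (\<Prod>i\<in>I. f (x i) * indicator (A i) (x i)) \<partial>(\<Pi>\<^sub>M i\<in>I. P))"
    proof (intro nn_integral_cong)
      fix x assume x: "x \<in> space (\<Pi>\<^sub>M i\<in>I. P)"
      \<comment> \<open>Points of the product space are extensional, so the coordinates in
        \<open>I\<close> decide membership in the box.\<close>
      have "(indicator (Pi\<^sub>E I A) x :: ennreal) = (\<Prod>i\<in>I. indicator (A i) (x i))"
        using x \<open>finite I\<close> by (auto simp: indicator_def space_PiM PiE_iff prod_zero_iff)
      then show "(\<Prod>i\<in>I. f (x i)) * indicator (Pi\<^sub>E I A) x = (\<Prod>i\<in>I. f (x i) * indicator (A i) (x i))"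
        by (simp add: prod.distrib)
    qed
    also have "\<dots> = (\<Prod>i\<in>I. \<integral>\<^sup>+ x. f x * indicator (A i) x \<partial>P)"
      using A' \<open>finite I\<close> by (intro P.product_nn_integral_prod) auto
    also have "\<dots> = (\<Prod>i\<in>I. emeasure (density P f) (A i))"
      using A' by (intro prod.cong) (auto simp: emeasure_density)
    finally show "emeasure (density (\<Pi>\<^sub>M i\<in>I. P) (\<lambda>x. \<Prod>i\<in>I. f (x i))) (Pi\<^sub>E I A)
        = (\<Prod>i\<in>I. emeasure (density P f) (A i))" .
  qed (use \<open>finite I\<close> in auto)
qed

section \<open>The sampling law as an orbit mixture\<close>

lemma sets_sample_law [measurable_cong, simp]: "sets (sample_law \<sigma> \<theta>) = sets borel"
  by (simp add: sample_law_def)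

text \<open>Constant vectors are fixed by every shift, so the mean \<open>\<mu>\<close> can be
  pulled out of the orbit; averaging the Cameron-Martin weights over the shifts then gives
  \<open>orbit_density u\<close>.\<close>

lemma nn_integral_sample_law:
  fixes u :: "'l::finite signal"
  assumes [measurable]: "h \<in> borel_measurable borel"
  shows "(\<integral>\<^sup>+ x. h x \<partial>sample_law \<sigma> (\<sigma> *\<^sub>R u + (\<chi> i. \<mu>))) =
    (\<integral>\<^sup>+ x. ennreal (orbit_density u x) * h (\<sigma> *\<^sub>R x + (\<chi> i. \<mu>)) \<partial>std_gaussian)"
proof -
  interpret prob_space "std_gaussian :: 'l signal measure" by (rule prob_space_std_gaussian)
  let ?U = "uniform_count_measure (cyclic_shifts :: ('l signal \<Rightarrow> 'l signal) set)"
  let ?\<theta> = "\<sigma> *\<^sub>R u + (\<chi> i. \<mu>)"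
  have fin: "finite (cyclic_shifts :: ('l signal \<Rightarrow> 'l signal) set)" by (simp add: cyclic_shifts_def)
  have cardS: "card (cyclic_shifts :: ('l signal \<Rightarrow> 'l signal) set) = CARD('l)"
    unfolding cyclic_shifts_def using card_image[OF inj_cyclic_shift] by simp
  have shift: "cyclic_shift l ?\<theta> + \<sigma> *\<^sub>R \<xi> = \<sigma> *\<^sub>R (\<xi> + cyclic_shift l u) + (\<chi> i. \<mu>)" for l \<xi>
    by (simp add: vec_eq_iff cyclic_shift_nth algebra_simps)
  \<comment> \<open>The first factor is finite and discrete, so joint measurability reduces to that
    of the map for each fixed shift.\<close>
  have [measurable]: "(\<lambda>(G, \<xi>). G ?\<theta> + \<sigma> *\<^sub>R \<xi>) \<in> borel_measurable (?U \<Otimes>\<^sub>M std_gaussian)"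
  proof -
    have "sets (?U \<Otimes>\<^sub>M std_gaussian) = sets (count_space cyclic_shifts \<Otimes>\<^sub>M (std_gaussian :: 'l signal measure))"
      by (intro sets_pair_measure_cong) (auto simp: sets_uniform_count_measure)
    moreover have "(\<lambda>(G, \<xi>). G ?\<theta> + \<sigma> *\<^sub>R \<xi>) \<in> borel_measurable (count_space cyclic_shifts \<Otimes>\<^sub>M (std_gaussian :: 'l signal measure))"
      by (rule measurable_pair_measure_countable1) (use fin in \<open>auto intro: countable_finite\<close>)
    ultimately show ?thesis
      using measurable_cong_sets by blast
  qed
  have "(\<integral>\<^sup>+ x. h x \<partial>sample_law \<sigma> ?\<theta>) =
      (\<integral>\<^sup>+ z. h ((\<lambda>(G, \<xi>). G ?\<theta> + \<sigma> *\<^sub>R \<xi>) z) \<partial>(?U \<Otimes>\<^sub>M std_gaussian))"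
    unfolding sample_law_def by (rule nn_integral_distr) auto
  also have "\<dots> = (\<integral>\<^sup>+ G. \<integral>\<^sup>+ \<xi>. h (G ?\<theta> + \<sigma> *\<^sub>R \<xi>) \<partial>std_gaussian \<partial>?U)"
    by (subst nn_integral_fst[symmetric]) auto
  also have "\<dots> = (\<Sum>G\<in>cyclic_shifts. (\<integral>\<^sup>+ \<xi>. h (G ?\<theta> + \<sigma> *\<^sub>R \<xi>) \<partial>std_gaussian)
      * ennreal (1 / real CARD('l)))"
    unfolding uniform_count_measure_def using fin cardS
    by (subst nn_integral_point_measure_finite) (auto simp: mult.commute)
  also have "\<dots> = (\<Sum>l\<in>UNIV. (\<integral>\<^sup>+ \<xi>. h (\<sigma> *\<^sub>R (\<xi> + cyclic_shift l u) + (\<chi> i. \<mu>)) \<partial>std_gaussian)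
      * ennreal (1 / real CARD('l)))"
    unfolding cyclic_shifts_def by (subst sum.reindex[OF inj_cyclic_shift]) (simp add: shift)
  also have "\<dots> = (\<Sum>l\<in>UNIV. (\<integral>\<^sup>+ x. ennreal (exp (x \<bullet> cyclic_shift l u - (u \<bullet> u) / 2)) *
      h (\<sigma> *\<^sub>R x + (\<chi> i. \<mu>)) \<partial>std_gaussian) * ennreal (1 / real CARD('l)))"
    by (subst nn_integral_std_gaussian_translate) (auto simp: inner_cyclic_shift)
  also have "\<dots> = (\<integral>\<^sup>+ x. (\<Sum>l\<in>UNIV. ennreal (exp (x \<bullet> cyclic_shift l u - (u \<bullet> u) / 2)) *
      h (\<sigma> *\<^sub>R x + (\<chi> i. \<mu>)) * ennreal (1 / real CARD('l))) \<partial>std_gaussian)"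
    by (subst nn_integral_sum) (auto simp: nn_integral_multc)
  also have "\<dots> = (\<integral>\<^sup>+ x. ennreal (orbit_density u x) * h (\<sigma> *\<^sub>R x + (\<chi> i. \<mu>)) \<partial>std_gaussian)"
  proof (intro nn_integral_cong)
    fix x
    have "ennreal (orbit_density u x) =
       (\<Sum>l\<in>UNIV. ennreal (exp (x \<bullet> cyclic_shift l u - (u \<bullet> u) / 2)) * ennreal (1 / real CARD('l)))"
      by (simp add: orbit_density_def sum_divide_distrib sum_ennreal[symmetric] ennreal_mult[symmetric]
         del: sum_ennreal)
    then show "(\<Sum>l\<in>UNIV. ennreal (exp (x \<bullet> cyclic_shift l u - (u \<bullet> u) / 2)) *
      h (\<sigma> *\<^sub>R x + (\<chi> i. \<mu>)) * ennreal (1 / real CARD('l))) = ennreal (orbit_density u x) * h (\<sigma> *\<^sub>R x + (\<chi> i. \<mu>))"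
      by (simp add: sum_distrib_left mult.commute mult.left_commute)
  qed
  finally show ?thesis .
qed

lemma prob_space_sample_law:
  fixes u :: "'l::finite signal"
  shows "prob_space (sample_law \<sigma> (\<sigma> *\<^sub>R u + (\<chi> i. \<mu>)))"
proof (rule prob_spaceI)
  have "(\<integral>\<^sup>+ x. ennreal (orbit_density u x) \<partial>std_gaussian) = 1"
    using nn_integral_eq_integral[OF integrable_orbit_density[of u]]
    by (simp add: integral_orbit_density less_imp_le orbit_density_pos)
  then show "emeasure (sample_law \<sigma> (\<sigma> *\<^sub>R u + (\<chi> i. \<mu>))) (space (sample_law \<sigma> (\<sigma> *\<^sub>R u + (\<chi> i. \<mu>)))) = 1"
    using nn_integral_sample_law[of "\<lambda>_. 1" \<sigma> u \<mu>] by simp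
qed

text \<open>Both laws are images of orbit mixtures under the same affine map, because they share
  \<open>\<mu>\<close>; the likelihood ratio is the ratio of the orbit densities at the preimage,
  which exists since \<open>\<sigma> \<noteq> 0\<close>.\<close>

lemma sample_law_eq_density:
  fixes u v :: "'l::finite signal"
  assumes "\<sigma> \<noteq> 0"
  shows "sample_law \<sigma> (\<sigma> *\<^sub>R v + (\<chi> i. \<mu>)) =
    density (sample_law \<sigma> (\<sigma> *\<^sub>R u + (\<chi> i. \<mu>)))
      (\<lambda>x. ennreal (orbit_density v ((x - (\<chi> i. \<mu>)) /\<^sub>R \<sigma>) / orbit_density u ((x - (\<chi> i. \<mu>)) /\<^sub>R \<sigma>)))"
    (is "?Q = density ?P ?f")
proof (rule measure_eqI)
  fix A assume "A \<in> sets ?Q"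
  then have [measurable]: "A \<in> sets borel" by simp
  have [measurable]: "?f \<in> borel_measurable borel" by measurable
  have "emeasure ?Q A = (\<integral>\<^sup>+ x. indicator A x \<partial>?Q)" by simp
  also have "\<dots> = (\<integral>\<^sup>+ x. ennreal (orbit_density v x) * indicator A (\<sigma> *\<^sub>R x + (\<chi> i. \<mu>)) \<partial>std_gaussian)"
    by (rule nn_integral_sample_law) auto
  also have "\<dots> = (\<integral>\<^sup>+ x. ennreal (orbit_density u x) *
      (?f (\<sigma> *\<^sub>R x + (\<chi> i. \<mu>)) * indicator A (\<sigma> *\<^sub>R x + (\<chi> i. \<mu>))) \<partial>std_gaussian)"
  proof (intro nn_integral_cong)
    fix x
    have "ennreal (orbit_density v x) = ennreal (orbit_density u x) * ennreal (orbit_density v x / orbit_density u x)"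
      using orbit_density_pos[of u x] orbit_density_pos[of v x] by (simp add: ennreal_mult[symmetric])
    then show "ennreal (orbit_density v x) * indicator A (\<sigma> *\<^sub>R x + (\<chi> i. \<mu>)) =
      ennreal (orbit_density u x) * (?f (\<sigma> *\<^sub>R x + (\<chi> i. \<mu>)) * indicator A (\<sigma> *\<^sub>R x + (\<chi> i. \<mu>)))"
      using assms by (simp add: mult.assoc)
  qed
  also have "\<dots> = (\<integral>\<^sup>+ x. ?f x * indicator A x \<partial>?P)"
    by (rule nn_integral_sample_law[symmetric]) measurable
  also have "\<dots> = emeasure (density ?P ?f) A"
    by (rule emeasure_density[symmetric]) auto
  finally show "emeasure ?Q A = emeasure (density ?P ?f) A" .
qed simp

section \<open>Separation of orbits and the risk from n samples\<close>

lemma orbit_dist_alt: "orbit_dist x \<theta> = Min (range (\<lambda>l. norm (x - cyclic_shift l \<theta>)))"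
  by (simp add: orbit_dist_def cyclic_shifts_def image_image)

lemma measurable_orbit_dist [measurable]: "(\<lambda>x. orbit_dist x \<theta>) \<in> borel_measurable borel"
  unfolding orbit_dist_alt by (intro borel_measurable_Min) auto

lemma orbit_dist_nonneg: "0 \<le> orbit_dist x \<theta>"
  unfolding orbit_dist_alt by simp

text \<open>The triangle inequality through \<open>x\<close>, taken at the shifts that attain the
  two minima.\<close>

lemma orbit_dist_separated:
  assumes "\<And>k l. \<delta> \<le> norm (cyclic_shift k \<theta> - cyclic_shift l \<phi>)"
  shows "\<delta> \<le> orbit_dist x \<theta> + orbit_dist x \<phi>"
proof -
  have ex: "\<exists>l. orbit_dist x \<psi> = norm (x - cyclic_shift l \<psi>)" for \<psi>
  proof -
    have "orbit_dist x \<psi> \<in> range (\<lambda>l. norm (x - cyclic_shift l \<psi>))"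
      unfolding orbit_dist_alt by (rule Min_in) auto
    then show ?thesis by auto
  qed
  from ex[of \<theta>] ex[of \<phi>] obtain k l where kl: "orbit_dist x \<theta> = norm (x - cyclic_shift k \<theta>)"
    "orbit_dist x \<phi> = norm (x - cyclic_shift l \<phi>)" by blast
  have "norm (cyclic_shift k \<theta> - cyclic_shift l \<phi>) \<le> norm (x - cyclic_shift l \<phi>) + norm (x - cyclic_shift k \<theta>)"
    using norm_triangle_ineq4[of "x - cyclic_shift l \<phi>" "x - cyclic_shift k \<theta>"] by simp
  with assms[of k l] kl show ?thesis by simp
qed

text \<open>The second moment of the likelihood ratio is multiplicative over samples. The allowance
  \<open>1 / (2 * real n)\<close> per sample is chosen so that the \<open>n\<close>-th power stays
  below \<open>exp (1 / 2)\<close>, hence below the 2 that the two-point bound requires.\<close>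

lemma risk_two_point:
  fixes u v :: "'l::finite signal" and \<sigma> \<mu> \<delta> :: real
  defines "\<theta> \<equiv> \<sigma> *\<^sub>R u + (\<chi> i. \<mu>)" and "\<phi> \<equiv> \<sigma> *\<^sub>R v + (\<chi> i. \<mu>)"
  assumes "\<sigma> \<noteq> 0" "1 \<le> n" "0 \<le> \<delta>" and est: "est \<in> estimators n"
    and chi: "(\<integral>\<^sup>+ x. ennreal ((orbit_density v x)\<^sup>2 / orbit_density u x) \<partial>std_gaussian)
        \<le> ennreal (1 + 1 / (2 * real n))"
    and sep: "\<And>k l. \<delta> \<le> norm (cyclic_shift k \<theta> - cyclic_shift l \<phi>)"
  shows "ennreal (\<delta> / 2) \<le> risk \<sigma> n est \<theta> + risk \<sigma> n est \<phi>"
proof -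
  define f where "f x = orbit_density v ((x - (\<chi> i. \<mu>)) /\<^sub>R \<sigma>) / orbit_density u ((x - (\<chi> i. \<mu>)) /\<^sub>R \<sigma>)" for x
  define \<Lambda> where "\<Lambda> X = (\<Prod>i<n. f (X i))" for X :: "nat \<Rightarrow> 'l signal"
  let ?P = "sample_law \<sigma> \<theta>" and ?Q = "sample_law \<sigma> \<phi>"
  let ?Pn = "\<Pi>\<^sub>M i\<in>{..<n}. ?P"
  have [measurable]: "f \<in> borel_measurable borel" unfolding f_def by measurable
  have f0: "0 \<le> f x" for x
    unfolding f_def by (intro divide_nonneg_nonneg less_imp_le orbit_density_pos)
  have Q: "?Q = density ?P (\<lambda>x. ennreal (f x))"
    unfolding \<theta>_def \<phi>_def f_def by (rule sample_law_eq_density) fact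
  interpret P: prob_space ?P unfolding \<theta>_def by (rule prob_space_sample_law)
  have pQ: "prob_space ?Q" unfolding \<phi>_def by (rule prob_space_sample_law)
  interpret P: product_sigma_finite "\<lambda>i::nat. ?P" by standard
  have "(\<Pi>\<^sub>M i\<in>{..<n}. ?Q) = density ?Pn (\<lambda>X. \<Prod>i<n. ennreal (f (X i)))"
    unfolding Q using pQ[unfolded Q] by (intro PiM_density) (auto intro: P.prob_space_axioms)
  then have Qn: "(\<Pi>\<^sub>M i\<in>{..<n}. ?Q) = density ?Pn (\<lambda>X. ennreal (\<Lambda> X))"
    by (simp add: \<Lambda>_def prod_ennreal f0)
  have setsPn: "sets ?Pn = sets (\<Pi>\<^sub>M i\<in>{..<n}. borel)" by (intro sets_PiM_cong) auto
  have \<Lambda>m [measurable]: "\<Lambda> \<in> borel_measurable ?Pn" unfolding \<Lambda>_def by measurable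
  have estm [measurable]: "est \<in> borel_measurable ?Pn"
    using est measurable_cong_sets[OF setsPn refl] unfolding estimators_def by blast
  have "(\<integral>\<^sup>+ x. ennreal (f x) \<partial>?P) = emeasure ?Q UNIV"
    unfolding Q by (subst emeasure_density) auto
  then have f1: "(\<integral>\<^sup>+ x. ennreal (f x) \<partial>?P) = 1"
    using prob_space.emeasure_space_1[OF pQ] sets_eq_imp_space_eq[OF sets_sample_law[of \<sigma> \<phi>]] by simp
  have "(\<integral>\<^sup>+ x. ennreal ((f x)\<^sup>2) \<partial>?P) =
     (\<integral>\<^sup>+ x. ennreal (orbit_density u x) * ennreal ((f (\<sigma> *\<^sub>R x + (\<chi> i. \<mu>)))\<^sup>2) \<partial>std_gaussian)"
    unfolding \<theta>_def by (rule nn_integral_sample_law) measurable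
  also have "\<dots> = (\<integral>\<^sup>+ x. ennreal ((orbit_density v x)\<^sup>2 / orbit_density u x) \<partial>std_gaussian)"
  proof (intro nn_integral_cong)
    fix x
    show "ennreal (orbit_density u x) * ennreal ((f (\<sigma> *\<^sub>R x + (\<chi> i. \<mu>)))\<^sup>2) =
        ennreal ((orbit_density v x)\<^sup>2 / orbit_density u x)"
      using orbit_density_pos[of u x] \<open>\<sigma> \<noteq> 0\<close>
      by (simp add: f_def ennreal_mult[symmetric] power2_eq_square)
  qed
  finally have f2: "(\<integral>\<^sup>+ x. ennreal ((f x)\<^sup>2) \<partial>?P) \<le> ennreal (1 + 1 / (2 * real n))"
    using chi by simp
  have prod: "(\<integral>\<^sup>+ X. (\<Prod>i<n. g (X i)) \<partial>?Pn) = (\<integral>\<^sup>+ x. g x \<partial>?P) ^ n"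
    if "g \<in> borel_measurable borel" for g :: "_ \<Rightarrow> ennreal"
    using that by (subst P.product_nn_integral_prod) (auto cong: measurable_cong_sets)
  have "(\<integral>\<^sup>+ X. ennreal (\<Lambda> X) \<partial>?Pn) = 1"
    using prod[of "\<lambda>x. ennreal (f x)"] by (simp add: \<Lambda>_def prod_ennreal f0 f1)
  moreover have "(\<integral>\<^sup>+ X. ennreal ((\<Lambda> X)\<^sup>2) \<partial>?Pn) \<le> 2"
  proof -
    have "(\<integral>\<^sup>+ X. ennreal ((\<Lambda> X)\<^sup>2) \<partial>?Pn) = (\<integral>\<^sup>+ x. ennreal ((f x)\<^sup>2) \<partial>?P) ^ n"
      using prod[of "\<lambda>x. ennreal ((f x)\<^sup>2)"] by (simp add: \<Lambda>_def prod_ennreal prod_power_distrib)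
    also have "\<dots> \<le> ennreal (1 + 1 / (2 * real n)) ^ n"
      by (intro power_mono f2) auto
    also have "\<dots> = ennreal ((1 + 1 / (2 * real n)) ^ n)"
      by (rule ennreal_power) simp
    also have "(1 + 1 / (2 * real n)) ^ n \<le> exp (1 / (2 * real n)) ^ n"
      by (intro power_mono exp_ge_add_one_self) auto
    also have "exp (1 / (2 * real n)) ^ n = exp (1 / 2)"
      using \<open>1 \<le> n\<close> by (simp add: exp_of_nat_mult[symmetric])
    also have "\<dots> \<le> 2" by (rule exp_half_le2)
    finally show ?thesis by (simp add: ennreal_leI)
  qed
  moreover have "ennreal \<delta> \<le> ennreal (orbit_dist (est X) \<theta>) + ennreal (orbit_dist (est X) \<phi>)" for X
    using orbit_dist_separated[of \<delta> \<theta> \<phi> "est X"] sep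
    by (simp add: ennreal_plus[symmetric] orbit_dist_nonneg ennreal_leI del: ennreal_plus)
  ultimately show ?thesis
    unfolding risk_def Qn using \<open>0 \<le> \<delta>\<close>
    by (intro chi_square_two_point) (auto simp: \<Lambda>_def f0 prod_nonneg)
qed

section \<open>The perturbed pair of signals\<close>

text \<open>The point is that \<open>C\<close> is fixed before \<open>\<sigma>\<close>,
  \<open>\<delta>\<close> and \<open>n\<close>: the noise level enters the exponential factors only
  through \<open>B / \<sigma>\<close>, which \<open>norm \<theta> \<le> \<sigma>\<close> bounds by
  \<open>B / norm \<theta>\<close>.\<close>

lemma risk_two_point_perturbation:
  fixes \<theta> d :: "'l::finite signal"
  assumes "\<theta> \<noteq> 0" and d0: "(\<Sum>i\<in>UNIV. d $ i) = 0"
  obtains C where "0 \<le> C" and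
    "\<And>\<sigma> \<delta> n est. 0 < \<sigma> \<Longrightarrow> norm \<theta> \<le> \<sigma> \<Longrightarrow> 0 \<le> \<delta> \<Longrightarrow> \<delta> \<le> 1 \<Longrightarrow> 1 \<le> n \<Longrightarrow>
      C * \<delta>\<^sup>2 * real n \<le> \<sigma> ^ 4 \<Longrightarrow> est \<in> estimators n \<Longrightarrow>
      (\<And>k l. \<delta> \<le> norm (cyclic_shift k \<theta> - cyclic_shift l (\<theta> + \<delta> *\<^sub>R d))) \<Longrightarrow>
      ennreal (\<delta> / 2) \<le> risk \<sigma> n est \<theta> + risk \<sigma> n est (\<theta> + \<delta> *\<^sub>R d)"
proof -
  define \<mu> where "\<mu> = (\<Sum>i\<in>UNIV. \<theta> $ i) / real CARD('l)"
  define \<theta>0 where "\<theta>0 = \<theta> - (\<chi> i. \<mu>)"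
  \<comment> \<open>Since \<open>\<delta> \<le> 1\<close>, the quotient \<open>B / \<sigma>\<close>
    bounds the norms of both the rescaled centred signal and the rescaled perturbation.\<close>
  define B where "B = norm \<theta>0 + norm d"
  \<comment> \<open>The exponent 5 collects 4 from the kernel bound and 1 from the lower bound on
    the density; 10 is twice the kernel constant 5, to match the target
    \<open>1 / (2 * real n)\<close>.\<close>
  define C where "C = 10 * exp (5 * (B / norm \<theta>)\<^sup>2) * B\<^sup>2 * (norm d)\<^sup>2"
  have \<theta>0: "(\<Sum>i\<in>UNIV. \<theta>0 $ i) = 0"
    by (simp add: \<theta>0_def sum_subtractf \<mu>_def)
  have B: "0 \<le> B" by (simp add: B_def)
  have C: "0 \<le> C" by (simp add: C_def)
  have "ennreal (\<delta> / 2) \<le> risk \<sigma> n est \<theta> + risk \<sigma> n est (\<theta> + \<delta> *\<^sub>R d)"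
    if \<sigma>: "0 < \<sigma>" "norm \<theta> \<le> \<sigma>" and \<delta>: "0 \<le> \<delta>" "\<delta> \<le> 1" and n: "1 \<le> n"
      and small: "C * \<delta>\<^sup>2 * real n \<le> \<sigma> ^ 4" and est: "est \<in> estimators n"
      and sep: "\<And>k l. \<delta> \<le> norm (cyclic_shift k \<theta> - cyclic_shift l (\<theta> + \<delta> *\<^sub>R d))"
    for \<sigma> \<delta> n and est :: "(nat \<Rightarrow> 'l signal) \<Rightarrow> 'l signal"
  proof -
    define u where "u = \<theta>0 /\<^sub>R \<sigma>"
    define w where "w = (\<delta> / \<sigma>) *\<^sub>R d"
    define b where "b = B / \<sigma>"
    have eqs: "\<theta> = \<sigma> *\<^sub>R u + (\<chi> i. \<mu>)" "\<theta> + \<delta> *\<^sub>R d = \<sigma> *\<^sub>R (u + w) + (\<chi> i. \<mu>)"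
      using \<sigma> by (simp_all add: u_def w_def \<theta>0_def scaleR_add_right)
    have u0: "(\<Sum>i\<in>UNIV. u $ i) = 0"
      using \<theta>0 by (simp add: u_def sum_distrib_left[symmetric])
    have w0: "(\<Sum>i\<in>UNIV. w $ i) = 0"
      using d0 by (simp add: w_def sum_distrib_left[symmetric] sum_divide_distrib[symmetric])
    have nu: "norm u \<le> b"
      using \<sigma> by (simp add: u_def b_def B_def divide_inverse mult.commute)
    have nw_eq: "norm w = \<delta> / \<sigma> * norm d" using \<sigma> \<delta> by (simp add: w_def)
    have "\<delta> * norm d \<le> 1 * norm d" using \<delta> by (intro mult_right_mono) auto
    also have "\<dots> \<le> B" by (simp add: B_def)
    finally have nw: "norm w \<le> b" using \<sigma> by (simp add: nw_eq b_def divide_right_mono)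
    have bB: "b\<^sup>2 \<le> (B / norm \<theta>)\<^sup>2"
      unfolding b_def using \<sigma> B \<open>\<theta> \<noteq> 0\<close> by (intro power_mono divide_left_mono) auto
    have "u \<bullet> u = (norm u)\<^sup>2" by (simp add: power2_norm_eq_inner)
    also have "\<dots> \<le> b\<^sup>2" using nu by (intro power_mono) auto
    finally have uu: "u \<bullet> u / 2 \<le> b\<^sup>2" using inner_ge_zero[of u] by linarith
    have "exp (u \<bullet> u / 2) * (orbit_kernel u u - 2 * orbit_kernel u (u + w) + orbit_kernel (u + w) (u + w))
        \<le> exp (u \<bullet> u / 2) * (5 * exp (4 * b\<^sup>2) * b\<^sup>2 * (norm w)\<^sup>2)"
      by (intro mult_left_mono orbit_kernel_difference_le w0 nu nw) auto
    also have "\<dots> \<le> exp (b\<^sup>2) * (5 * exp (4 * b\<^sup>2) * b\<^sup>2 * (norm w)\<^sup>2)"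
      using uu by (intro mult_right_mono) auto
    also have "\<dots> = exp (5 * b\<^sup>2) * (5 * b\<^sup>2 * (norm w)\<^sup>2)"
      by (simp add: mult_exp_exp)
    also have "\<dots> \<le> exp (5 * (B / norm \<theta>)\<^sup>2) * (5 * b\<^sup>2 * (norm w)\<^sup>2)"
      using bB by (intro mult_right_mono) auto
    also have "\<dots> = C * \<delta>\<^sup>2 / (2 * \<sigma> ^ 4)"
      by (simp add: C_def nw_eq b_def power_mult_distrib power_divide power4_eq_xxxx power2_eq_square ac_simps)
    also have "\<dots> \<le> 1 / (2 * real n)"
      using small \<sigma> n by (simp add: field_simps)
    finally have "1 + exp (u \<bullet> u / 2) * (orbit_kernel u u - 2 * orbit_kernel u (u + w) + orbit_kernel (u + w) (u + w))
      \<le> 1 + 1 / (2 * real n)" by simp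
    with chi_square_orbit_density_le[OF u0, of "u + w"]
    have "(\<integral>\<^sup>+ x. ennreal ((orbit_density (u + w) x)\<^sup>2 / orbit_density u x) \<partial>std_gaussian)
        \<le> ennreal (1 + 1 / (2 * real n))"
      using ennreal_leI order_trans by blast
    then show ?thesis
      using risk_two_point[of \<sigma> n \<delta> est "u + w" u \<mu>] \<sigma> \<delta> n est sep unfolding eqs[symmetric] by simp
  qed
  with C show thesis by (rule that)
qed

text \<open>Apart from the amplitude bounds, membership depends only on the support, so any member
  can be flattened to the midpoint of \<open>m\<close> and \<open>M\<close>. Strictness of
  \<open>m < M\<close> leaves room to move two amplitudes in opposite directions, which preserves
  the sum.\<close>

lemma separated_signals:
  fixes m M \<epsilon> :: real
  assumes "0 < m" "m < M" and ne: "with_sparsity s (sparse_signals m M \<epsilon>) \<noteq> ({} :: 'l::finite signal set)"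
  obtains \<theta> d :: "'l::finite signal" and \<delta>0 where "\<theta> \<noteq> 0" "(\<Sum>i\<in>UNIV. d $ i) = 0" "0 < \<delta>0" "\<delta>0 \<le> 1"
    "\<And>\<delta>. 0 \<le> \<delta> \<Longrightarrow> \<delta> \<le> \<delta>0 \<Longrightarrow> \<theta> + \<delta> *\<^sub>R d \<in> with_sparsity s (sparse_signals m M \<epsilon>)"
    "\<And>\<delta> k l. 0 \<le> \<delta> \<Longrightarrow> \<delta> \<le> \<delta>0 \<Longrightarrow> \<delta> \<le> norm (cyclic_shift k \<theta> - cyclic_shift l (\<theta> + \<delta> *\<^sub>R d))"
proof -
  obtain \<psi> :: "'l signal" where \<psi>: "\<psi> \<in> with_sparsity s (sparse_signals m M \<epsilon>)" using ne by blast
  define c where "c = (m + M) / 2"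
  \<comment> \<open>Half of \<open>M - m\<close> is the distance from \<open>c\<close> to either
    amplitude bound; the cap 1 matches the range of \<open>\<delta>\<close> in the perturbation
    bound.\<close>
  define \<delta>0 where "\<delta>0 = min 1 ((M - m) / 2)"
  have "7 \<le> card (supp \<psi>)" using \<psi> by (simp add: with_sparsity_def sparse_signals_def)
  then have "\<not> card (supp \<psi>) \<le> 1" by simp
  then obtain a b where ab: "a \<in> supp \<psi>" "b \<in> supp \<psi>" "a \<noteq> b"
    using card_le_Suc0_iff_eq[of "supp \<psi>"] by auto
  define \<theta> :: "'l signal" where "\<theta> = (\<chi> i. if i \<in> supp \<psi> then c else 0)"
  define d :: "'l signal" where "d = axis a 1 - axis b 1"
  have nth: "(\<theta> + \<delta> *\<^sub>R d) $ i =
    (if i = a then c + \<delta> else if i = b then c - \<delta> else if i \<in> supp \<psi> then c else 0)" for \<delta> i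
    using ab by (simp add: \<theta>_def d_def axis_def)
  have c: "0 < c" using assms by (simp add: c_def)
  have "\<theta> $ a \<noteq> 0" using ab c by (simp add: \<theta>_def)
  then have "\<theta> \<noteq> 0" by auto
  moreover have "(\<Sum>i\<in>UNIV. d $ i) = 0" by (simp add: d_def sum_subtractf axis_def)
  moreover have "0 < \<delta>0" "\<delta>0 \<le> 1" using assms by (auto simp: \<delta>0_def)
  moreover have "\<theta> + \<delta> *\<^sub>R d \<in> with_sparsity s (sparse_signals m M \<epsilon>)" if "0 \<le> \<delta>" "\<delta> \<le> \<delta>0" for \<delta>
  proof -
    have \<delta>: "0 \<le> \<delta>" "m \<le> c - \<delta>" "c + \<delta> \<le> M"
      using that by (auto simp: \<delta>0_def c_def field_simps)
    have supp: "supp (\<theta> + \<delta> *\<^sub>R d) = supp \<psi>"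
      using \<delta> ab \<open>0 < m\<close> unfolding supp_def[of "\<theta> + \<delta> *\<^sub>R d"] nth by auto
    have "m \<le> \<bar>(\<theta> + \<delta> *\<^sub>R d) $ i\<bar> \<and> \<bar>(\<theta> + \<delta> *\<^sub>R d) $ i\<bar> \<le> M" if "i \<in> supp \<psi>" for i
      using \<delta> that \<open>0 < m\<close> unfolding nth by auto
    moreover have "collision_free (\<theta> + \<delta> *\<^sub>R d) \<longleftrightarrow> collision_free \<psi>"
      by (simp add: collision_free_def differences_def supp)
    ultimately show ?thesis
      using \<psi> unfolding with_sparsity_def sparse_signals_def mem_Collect_eq supp by blast
  qed
  \<comment> \<open>one coordinate of the perturbed signal is \<open>c + \<delta>\<close>, whereas those of \<open>\<theta>\<close> are all \<open>0\<close> or \<open>c\<close>\<close>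
  moreover have "\<delta> \<le> norm (cyclic_shift k \<theta> - cyclic_shift l (\<theta> + \<delta> *\<^sub>R d))" if "0 \<le> \<delta>" for \<delta> k l
  proof -
    have "(\<theta> + \<delta> *\<^sub>R d) $ (a - l + l) = c + \<delta>" unfolding nth by simp
    then have "(cyclic_shift k \<theta> - cyclic_shift l (\<theta> + \<delta> *\<^sub>R d)) $ (a - l) = \<theta> $ (a - l + k) - (c + \<delta>)"
      by (simp add: cyclic_shift_nth)
    moreover have "\<delta> \<le> \<bar>\<theta> $ (a - l + k) - (c + \<delta>)\<bar>"
      using that c by (simp add: \<theta>_def)
    ultimately show ?thesis
      using component_le_norm_cart[of "cyclic_shift k \<theta> - cyclic_shift l (\<theta> + \<delta> *\<^sub>R d)" "a - l"] by simp
  qed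
  ultimately show thesis by (rule that)
qed

theorem theorem1p4p4:
  fixes m M \<epsilon> :: real and s :: nat
  assumes "0 < m" and "m < M" and "0 < \<epsilon>" and "1 \<le> s"
    and "with_sparsity s (sparse_signals m M \<epsilon>) \<noteq> ({} :: 'l::finite signal set)"
  shows "\<exists>A>0. \<forall>\<sigma>>0. \<forall>n\<ge>1.
    (\<forall>\<theta> \<in> with_sparsity s (sparse_signals m M \<epsilon>) :: 'l signal set. norm \<theta> \<le> \<sigma>) \<longrightarrow>
      (INF est \<in> estimators n.
         SUP \<theta> \<in> with_sparsity s (signal_class \<sigma> m M \<epsilon>) :: 'l signal set. risk \<sigma> n est \<theta>)
      \<ge> ennreal (A * min (\<sigma>\<^sup>2 / sqrt (real n)) 1)"
proof -
  obtain \<theta> d :: "'l signal" and \<delta>0 where \<theta>: "\<theta> \<noteq> 0" and d: "(\<Sum>i\<in>UNIV. d $ i) = 0"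
    and \<delta>0: "0 < \<delta>0" "\<delta>0 \<le> 1"
    and mem: "\<And>\<delta>. 0 \<le> \<delta> \<Longrightarrow> \<delta> \<le> \<delta>0 \<Longrightarrow> \<theta> + \<delta> *\<^sub>R d \<in> with_sparsity s (sparse_signals m M \<epsilon>)"
    and sep: "\<And>\<delta> k l. 0 \<le> \<delta> \<Longrightarrow> \<delta> \<le> \<delta>0 \<Longrightarrow> \<delta> \<le> norm (cyclic_shift k \<theta> - cyclic_shift l (\<theta> + \<delta> *\<^sub>R d))"
    using separated_signals[OF assms(1,2,5)] by blast
  obtain C where C: "0 \<le> C"
    and risk: "\<And>\<sigma> \<delta> n est. 0 < \<sigma> \<Longrightarrow> norm \<theta> \<le> \<sigma> \<Longrightarrow> 0 \<le> \<delta> \<Longrightarrow> \<delta> \<le> 1 \<Longrightarrow> 1 \<le> n \<Longrightarrow>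
      C * \<delta>\<^sup>2 * real n \<le> \<sigma> ^ 4 \<Longrightarrow> est \<in> estimators n \<Longrightarrow>
      (\<And>k l. \<delta> \<le> norm (cyclic_shift k \<theta> - cyclic_shift l (\<theta> + \<delta> *\<^sub>R d))) \<Longrightarrow>
      ennreal (\<delta> / 2) \<le> risk \<sigma> n est \<theta> + risk \<sigma> n est (\<theta> + \<delta> *\<^sub>R d)"
    using risk_two_point_perturbation[OF \<theta> d] by blast
  \<comment> \<open>This gives \<open>C * \<kappa>^2 \<le> 1\<close>, which is what the condition
    \<open>C * \<delta>^2 * real n \<le> \<sigma> ^ 4\<close> needs; \<open>C + 1\<close> keeps the
    quotient meaningful when \<open>C\<close> is zero.\<close>
  define \<kappa> where "\<kappa> = min \<delta>0 (1 / sqrt (C + 1))"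
  have \<kappa>: "0 < \<kappa>" "\<kappa> \<le> \<delta>0" using \<delta>0 C by (auto simp: \<kappa>_def)
  have "\<kappa>\<^sup>2 \<le> (1 / sqrt (C + 1))\<^sup>2" using \<kappa> by (intro power_mono) (auto simp: \<kappa>_def)
  also have "\<dots> = 1 / (C + 1)" using C by (simp add: power_divide)
  finally have "\<kappa>\<^sup>2 + C * \<kappa>\<^sup>2 \<le> 1"
    using C by (simp add: field_simps)
  then have C\<kappa>: "C * \<kappa>\<^sup>2 \<le> 1"
    using zero_le_power2[of \<kappa>] by linarith
  show ?thesis
  \<comment> \<open>One factor 1/2 comes from the two-point bound, the other from estimating a sum
    of two risks by twice the supremum.\<close>
  proof (intro exI[of _ "\<kappa> / 4"] conjI allI impI)
    show "0 < \<kappa> / 4" using \<kappa> by simp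
    fix \<sigma> :: real and n :: nat
    assume \<sigma>: "0 < \<sigma>" and n: "1 \<le> n"
      and bound: "\<forall>\<theta> \<in> with_sparsity s (sparse_signals m M \<epsilon>) :: 'l signal set. norm \<theta> \<le> \<sigma>"
    define \<delta> where "\<delta> = \<kappa> * min (\<sigma>\<^sup>2 / sqrt (real n)) 1"
    have "\<delta> \<le> \<kappa> * 1"
      unfolding \<delta>_def using \<kappa> by (intro mult_left_mono) auto
    moreover have "0 \<le> \<delta>"
      unfolding \<delta>_def using \<kappa> by (intro mult_nonneg_nonneg) auto
    ultimately have \<delta>: "0 \<le> \<delta>" "\<delta> \<le> \<delta>0"
      using \<kappa> by auto
    have "\<delta>\<^sup>2 \<le> (\<kappa> * (\<sigma>\<^sup>2 / sqrt (real n)))\<^sup>2"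
      using \<delta> \<kappa> unfolding \<delta>_def by (intro power_mono mult_left_mono) auto
    also have "\<dots> = \<kappa>\<^sup>2 * \<sigma> ^ 4 / real n"
      by (simp add: power_mult_distrib power_divide)
    finally have "C * (\<delta>\<^sup>2 * real n) \<le> C * (\<kappa>\<^sup>2 * \<sigma> ^ 4)"
      using C n by (intro mult_left_mono) (auto simp: field_simps)
    also have "\<dots> \<le> \<sigma> ^ 4"
      using mult_right_mono[OF C\<kappa>, of "\<sigma> ^ 4"] by (simp add: mult.assoc)
    finally have small: "C * \<delta>\<^sup>2 * real n \<le> \<sigma> ^ 4" by (simp add: mult.assoc)
    let ?T = "with_sparsity s (signal_class \<sigma> m M \<epsilon>) :: 'l signal set"
    have mem\<theta>: "\<theta> \<in> with_sparsity s (sparse_signals m M \<epsilon>)" using mem[of 0] \<delta>0 by simp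
    \<comment> \<open>The assumed bound on all norms supplies the noise condition, so both
      hypotheses lie in the class for this \<open>\<sigma>\<close>.\<close>
    have sub: "x \<in> ?T" if "x \<in> with_sparsity s (sparse_signals m M \<epsilon>)" for x
      using that bspec[OF bound that] by (simp add: with_sparsity_def signal_class_def)
    have T: "\<theta> \<in> ?T" "\<theta> + \<delta> *\<^sub>R d \<in> ?T"
      using sub[OF mem\<theta>] sub[OF mem[OF \<delta>]] by blast+
    have n\<theta>: "norm \<theta> \<le> \<sigma>" by (rule bspec[OF bound mem\<theta>])
    have "\<delta> \<le> 1" using \<delta> \<delta>0 by linarith
    show "ennreal (\<kappa> / 4 * min (\<sigma>\<^sup>2 / sqrt (real n)) 1) \<le>
      (INF est \<in> estimators n. SUP \<theta> \<in> ?T. risk \<sigma> n est \<theta>)"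
    proof (rule INF_greatest)
      fix est :: "(nat \<Rightarrow> 'l signal) \<Rightarrow> 'l signal" assume est: "est \<in> estimators n"
      let ?R = "SUP \<theta> \<in> ?T. risk \<sigma> n est \<theta>"
      have "ennreal (\<delta> / 2) \<le> risk \<sigma> n est \<theta> + risk \<sigma> n est (\<theta> + \<delta> *\<^sub>R d)"
        by (rule risk[OF \<sigma> n\<theta> \<delta>(1) \<open>\<delta> \<le> 1\<close> n small est sep[OF \<delta>]])
      also have "\<dots> \<le> ?R + ?R" by (rule add_mono[OF SUP_upper[OF T(1)] SUP_upper[OF T(2)]])
      finally have "ennreal (\<delta> / 2) \<le> 2 * ?R" unfolding mult_2 .
      also have "ennreal (\<delta> / 2) = 2 * ennreal (\<delta> / 4)"
        using ennreal_mult[of 2 "\<delta> / 4"] \<delta>(1) by simp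
      finally have "2 * ennreal (\<delta> / 4) \<le> 2 * ?R" .
      then have "ennreal (\<delta> / 4) \<le> ?R" by (simp add: ennreal_mult_le_mult_iff)
      then show "ennreal (\<kappa> / 4 * min (\<sigma>\<^sup>2 / sqrt (real n)) 1) \<le> ?R" by (simp add: \<delta>_def)
    qed
  qed
qed

end
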